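(* Let $d, D$ be positive integers such that $M_{\mathrm c}(d,D)<\infty$. Then $p_{\mathrm c}(d,D,M)\to 0$ as $M\to\infty$.
   Context: $\mathbb{Z}^d$ is the $d$-dimensional integer lattice, its elements are called sites, and $\|\cdot\|=\|\cdot\|_1$ denotes the $\ell^1$-norm. For a positive integer $M$, a map $f:\mathbb{Z}^d\to\mathbb{Z}^D$ is $M$-Lipschitz ($M$-Lip) if $\|f(x)-f(y)\|\le M$ for all $x,y\in\mathbb{Z}^d$ with $\|x-y\|=1$. Site percolation: for $p\in[0,1]$, each site of $\mathbb{Z}^D$ is declared open with probability $p$ and otherwise closed, independently for different sites. $W_p(\mathbb{Z}^D)$ is the random set of open sites and $\mathbb{P}_p$ is the associated (product) probability measure. Define $$L(d,D,M,p):=\mathbb{P}_p\bigl(\text{there exists an } M\text{-Lip injection from } \mathbb{Z}^d \text{ to } W_p(\mathbb{Z}^D)\bigr),$$ which takes values in $\{0,1\}$ and is increasing in $p$. Define $$p_{\mathrm c}(d,D,M):=\inf\{p\in[0,1]: L(d,D,M,p)=1\},$$ $$M_{\mathrm c}(d,D):=\min\{M\ge 1 \text{ integer}: p_{\mathrm c}(d,D,M)<1\},$$ with the conventions $\inf\varnothing:=\infty$ and $\min\varnothing:=\infty$. *)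

theory Defs
  imports "HOL-Probability.Probability" "HOL-Library.Extended_Nat"
begin

text \<open>The lattice of dimension \<open>CARD('d)\<close> is the type \<open>int ^ 'd\<close>; since finite types are
  nonempty and of every positive cardinality, the dimension ranges over all positive integers.\<close>

definition l1_norm :: "int ^ 'd::finite \<Rightarrow> int" where
  "l1_norm x = (\<Sum>i\<in>UNIV. \<bar>x $ i\<bar>)"

definition M_Lip :: "nat \<Rightarrow> (int ^ 'd::finite \<Rightarrow> int ^ 'D::finite) \<Rightarrow> bool" where
  "M_Lip M f \<longleftrightarrow> (\<forall>x y. l1_norm (x - y) = 1 \<longrightarrow> l1_norm (f x - f y) \<le> int M)"

definition site_percolation :: "real \<Rightarrow> (int ^ 'D::finite \<Rightarrow> bool) measure" where
  "site_percolation p = (\<Pi>\<^sub>M x\<in>UNIV. measure_pmf (bernoulli_pmf p))"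

definition open_sites :: "(int ^ 'D::finite \<Rightarrow> bool) \<Rightarrow> (int ^ 'D) set" where
  "open_sites \<omega> = {x. \<omega> x}"

text \<open>The event below is measurable: by compactness it is the union over the countably many values
  of \<open>f 0\<close> of a decreasing intersection of events depending on finitely many sites. Hence
  \<open>measure\<close> does not fall back to its default value 0.\<close>

definition Lip_prob :: "'d::finite itself \<Rightarrow> 'D::finite itself \<Rightarrow> nat \<Rightarrow> real \<Rightarrow> real" where
  "Lip_prob _ _ M p = measure (site_percolation p)
     {\<omega> \<in> space (site_percolation p).
        \<exists>f :: int ^ 'd \<Rightarrow> int ^ 'D. M_Lip M f \<and> inj f \<and> range f \<subseteq> open_sites \<omega>}"

text \<open>In \<open>ereal\<close> and \<open>enat\<close> the infimum of the empty set is \<open>\<infinity>\<close>, and a nonempty set of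
  natural numbers attains its infimum in \<open>enat\<close>.\<close>

definition p_crit :: "'d::finite itself \<Rightarrow> 'D::finite itself \<Rightarrow> nat \<Rightarrow> ereal" where
  "p_crit d D M = Inf (ereal ` {p \<in> {0..1}. Lip_prob d D M p = 1})"

definition M_crit :: "'d::finite itself \<Rightarrow> 'D::finite itself \<Rightarrow> enat" where
  "M_crit d D = Inf (enat ` {M. M \<ge> 1 \<and> p_crit d D M < 1})"

end

theory Submission imports Defs begin

text \<open>The proof is a renormalisation argument. Since \<open>M_crit\<close> is finite, there are \<open>M0\<close> and
  \<open>p0 < 1\<close> such that \<open>M0\<close>-Lipschitz injections into the open sites exist almost surely at
  parameter \<open>p0\<close>. Tile \<open>\<int>\<^sup>D\<close> by cubes of side \<open>n\<close> and call a cube good if it contains an open site.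
  Cubes are good independently of each other, with probability \<open>1 - (1 - p) ^ n ^ D\<close>, so the
  configuration of good cubes is again site percolation on \<open>\<int>\<^sup>D\<close> (\<open>distr_coarse\<close>). At the value
  \<open>p = 1 - (1 - p0) powr (1 / n ^ D)\<close> its parameter is exactly \<open>p0\<close>. Hence almost surely
  \<open>\<int>\<^sup>d\<close> embeds into the good cubes with constant \<open>M0\<close>, and choosing an open site in each
  cube turns this into an embedding into open sites with constant \<open>n * (M0 + D)\<close>
  (\<open>embedding_event_refine\<close>). Therefore \<open>p_crit\<close> is at most this \<open>p\<close> for every
  \<open>M \<ge> n * (M0 + D)\<close>, and \<open>p\<close> tends to 0 as \<open>n\<close> grows.

  Comparing the probabilities of the two embedding events requires that the event is measurable.
  It involves an existential quantifier over uncountably many maps; compactness replaces this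
  quantifier by countably many conditions on finite sets of sites
  (\<open>ex_open_Lip_inj_iff_finite\<close>).\<close>

section \<open>Finite boxes and the l1 norm\<close>

lemma
  fixes A :: "'n::finite \<Rightarrow> 'a set"
  assumes "\<And>i. finite (A i)"
  shows finite_box: "finite {z :: 'a ^ 'n. \<forall>i. z $ i \<in> A i}"
    and card_box: "card {z :: 'a ^ 'n. \<forall>i. z $ i \<in> A i} = (\<Prod>i\<in>UNIV. card (A i))"
proof -
  have box: "{z :: 'a ^ 'n. \<forall>i. z $ i \<in> A i} = vec_lambda ` (PiE UNIV A)"
  proof (intro set_eqI iffI)
    fix z :: "'a ^ 'n" assume "z \<in> {z. \<forall>i. z $ i \<in> A i}"
    then have "vec_nth z \<in> PiE UNIV A" "z = vec_lambda (vec_nth z)" by auto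
    then show "z \<in> vec_lambda ` (PiE UNIV A)" by blast
  qed auto
  show "finite {z :: 'a ^ 'n. \<forall>i. z $ i \<in> A i}"
    unfolding box by (intro finite_imageI finite_PiE) (use assms in auto)
  have "inj_on (vec_lambda :: _ \<Rightarrow> 'a ^ 'n) (PiE UNIV A)"
    by (rule inj_onI) (metis UNIV_I vec_lambda_inverse)
  then show "card {z :: 'a ^ 'n. \<forall>i. z $ i \<in> A i} = (\<Prod>i\<in>UNIV. card (A i))"
    unfolding box by (simp add: card_image card_PiE)
qed

lemma l1_norm_nonneg: "0 \<le> l1_norm x"
  unfolding l1_norm_def by (intro sum_nonneg) auto

lemma abs_component_le_l1_norm: "\<bar>x $ i\<bar> \<le> l1_norm x"
  unfolding l1_norm_def by (rule member_le_sum) auto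

lemma l1_norm_le_0_iff: "l1_norm x \<le> 0 \<longleftrightarrow> x = 0"
proof
  assume "l1_norm x \<le> 0"
  then have "\<bar>x $ i\<bar> \<le> 0" for i
    using abs_component_le_l1_norm[of x i] by linarith
  then show "x = 0" by (simp add: vec_eq_iff)
qed (simp add: l1_norm_def)

lemma l1_norm_triangle: "l1_norm (x + y) \<le> l1_norm x + l1_norm y"
  unfolding l1_norm_def sum.distrib[symmetric] by (intro sum_mono) auto

lemma finite_l1_ball: "finite {z :: int ^ 'n::finite. l1_norm (z - v) \<le> r}"
proof (rule finite_subset)
  show "{z. l1_norm (z - v) \<le> r} \<subseteq> {z. \<forall>i. z $ i \<in> {v $ i - r .. v $ i + r}}"
  proof clarify
    fix z i assume "l1_norm (z - v) \<le> r"
    then have "\<bar>(z - v) $ i\<bar> \<le> r"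
      using abs_component_le_l1_norm order_trans by blast
    then show "z $ i \<in> {v $ i - r .. v $ i + r}" by auto
  qed
qed (rule finite_box, simp)

text \<open>Two sites at distance \<open>n\<close> are joined by a path of \<open>n\<close> unit steps, obtained by repeatedly
  correcting a coordinate in which they differ.\<close>

lemma M_Lip_iff_dist:
  "M_Lip M f \<longleftrightarrow> (\<forall>x y. l1_norm (f x - f y) \<le> int M * l1_norm (x - y))"
proof
  assume Lip: "M_Lip M f"
  have "l1_norm (f x - f y) \<le> int M * int n" if "l1_norm (x - y) = int n" for n x y
    using that
  proof (induction n arbitrary: x)
    case 0
    then have "x = y" using l1_norm_le_0_iff[of "x - y"] by simp
    then show ?case by (simp add: l1_norm_def)
  next
    case (Suc n)
    then have "x - y \<noteq> 0" by (auto simp: l1_norm_def)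
    then obtain i where i: "x $ i \<noteq> y $ i" by (auto simp: vec_eq_iff)
    define x' where "x' = x - axis i (sgn (x $ i - y $ i))"
    have "l1_norm (axis i (s :: int)) = \<bar>s\<bar>" for s
      unfolding l1_norm_def axis_def by (simp add: if_distrib[of abs] cong: if_cong)
    then have step: "l1_norm (x - x') = 1"
      using i by (simp add: x'_def abs_sgn_eq)
    have "l1_norm (x - y) = \<bar>x $ i - y $ i\<bar> + (\<Sum>j\<in>UNIV - {i}. \<bar>x $ j - y $ j\<bar>)"
      unfolding l1_norm_def by (subst sum.remove[of _ i]) auto
    moreover have "l1_norm (x' - y) = \<bar>x' $ i - y $ i\<bar> + (\<Sum>j\<in>UNIV - {i}. \<bar>x' $ j - y $ j\<bar>)"
      unfolding l1_norm_def by (subst sum.remove[of _ i]) auto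
    moreover have "(\<Sum>j\<in>UNIV - {i}. \<bar>x' $ j - y $ j\<bar>) = (\<Sum>j\<in>UNIV - {i}. \<bar>x $ j - y $ j\<bar>)"
      by (rule sum.cong) (auto simp: x'_def axis_def)
    moreover have "\<bar>x' $ i - y $ i\<bar> = \<bar>x $ i - y $ i\<bar> - 1"
      using i by (auto simp: x'_def axis_def sgn_if)
    ultimately have "l1_norm (x' - y) = int n" using Suc.prems by simp
    then have "l1_norm (f x' - f y) \<le> int M * int n" by (rule Suc.IH)
    moreover have "l1_norm (f x - f x') \<le> int M" using Lip step by (simp add: M_Lip_def)
    moreover have "l1_norm (f x - f y) \<le> l1_norm (f x - f x') + l1_norm (f x' - f y)"
      using l1_norm_triangle[of "f x - f x'" "f x' - f y"] by simp
    ultimately show ?case by (simp add: algebra_simps)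
  qed
  from this[of _ _ "nat (l1_norm (_ - _))"]
  show "\<forall>x y. l1_norm (f x - f y) \<le> int M * l1_norm (x - y)"
    using l1_norm_nonneg by (metis nat_0_le)
next
  assume *: "\<forall>x y. l1_norm (f x - f y) \<le> int M * l1_norm (x - y)"
  show "M_Lip M f"
    unfolding M_Lip_def
  proof (intro allI impI)
    fix x y :: "int ^ 'a" assume "l1_norm (x - y) = 1"
    then show "l1_norm (f x - f y) \<le> int M" using *[rule_format, of x y] by simp
  qed
qed

section \<open>Measurability of the embedding event\<close>

text \<open>This is compactness of a countable product of finite sets, in sequential form. Along an
  enumeration of the index set, the pigeonhole principle gives nested infinite sets of
  approximate solutions that agree on ever more indices; the limit agrees on every finite set
  with some approximate solution.\<close>

lemma finite_choices_compactness:
  fixes B :: "'a::countable \<Rightarrow> 'b set"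
  assumes fin: "\<And>x. finite (B x)"
    and local: "\<And>S f g. (\<And>x. x \<in> S \<Longrightarrow> f x = g x) \<Longrightarrow> Q S f \<Longrightarrow> Q S g"
    and mono: "\<And>S T f. S \<subseteq> T \<Longrightarrow> Q T f \<Longrightarrow> Q S f"
    and sol: "\<And>S. finite S \<Longrightarrow> \<exists>f\<in>PiE S B. Q S f"
  shows "\<exists>g. \<forall>S. finite S \<longrightarrow> Q S g"
proof -
  define X :: "nat \<Rightarrow> 'a" where "X = from_nat"
  have "\<exists>f\<in>PiE (X ` {..<n}) B. Q (X ` {..<n}) f" for n by (rule sol) simp
  then obtain f where f: "\<And>n. f n \<in> PiE (X ` {..<n}) B" "\<And>n. Q (X ` {..<n}) (f n)" by metis
  have "\<exists>A. \<forall>n. infinite (A n) \<and>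
      (A (Suc n) \<subseteq> A n \<and> (\<exists>b. \<forall>m\<in>A (Suc n). n < m \<and> f m (X n) = b))"
  proof (rule dependent_nat_choice)
    show "\<exists>A :: nat set. infinite A" using infinite_UNIV_nat by blast
  next
    fix A :: "nat set" and n assume "infinite A"
    then have inf: "infinite (A - {..n})" by simp
    have "f m (X n) \<in> B (X n)" if "n < m" for m
      using f(1)[of m] that by (auto simp: PiE_iff)
    then have "(\<lambda>m. f m (X n)) ` (A - {..n}) \<subseteq> B (X n)"
      by (intro image_subsetI) (simp add: not_le)
    then have "finite ((\<lambda>m. f m (X n)) ` (A - {..n}))" using fin finite_subset by blast
    from pigeonhole_infinite[OF inf this] obtain a where
      "infinite {m \<in> A - {..n}. f m (X n) = f a (X n)}" by blast
    then show "\<exists>A'. infinite A' \<and> (A' \<subseteq> A \<and> (\<exists>b. \<forall>m\<in>A'. n < m \<and> f m (X n) = b))"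
      by (intro exI[of _ "{m \<in> A - {..n}. f m (X n) = f a (X n)}"]) auto
  qed
  then obtain A where A: "\<And>n. infinite (A n)" "\<And>n. A (Suc n) \<subseteq> A n"
    "\<And>n. \<exists>b. \<forall>m\<in>A (Suc n). n < m \<and> f m (X n) = b" by blast
  then obtain c where c: "\<And>n m. m \<in> A (Suc n) \<Longrightarrow> n < m \<and> f m (X n) = c n" by metis
  have anti: "A n \<subseteq> A k" if "k \<le> n" for k n
    using lift_Suc_antimono_le[of A] A(2) that by blast
  define g where "g x = c (to_nat x)" for x :: 'a
  have "Q S g" if S: "finite S" for S
  proof -
    obtain N where N: "to_nat ` S \<subseteq> {..<N}"
      using S finite_nat_iff_bounded by (metis finite_imageI)
    obtain m where "m \<in> A N" using A(1)[of N] by (metis finite.emptyI ex_in_conv)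
    then have "m \<in> A (Suc (to_nat x))" if "x \<in> S" for x
      using anti[of "Suc (to_nat x)" N] N that by (auto simp: Suc_le_eq)
    from c[OF this] have m: "to_nat x < m \<and> f m x = g x" if "x \<in> S" for x
      using that by (simp add: X_def g_def)
    have "S \<subseteq> X ` {..<m}"
    proof
      fix x assume "x \<in> S"
      then show "x \<in> X ` {..<m}" using m by (intro image_eqI[of _ _ "to_nat x"]) (auto simp: X_def)
    qed
    then have "Q S (f m)" using mono f(2) by blast
    then show "Q S g" using local m by blast
  qed
  then show ?thesis by blast
qed

text \<open>The Lipschitz condition is imposed here on all pairs of sites, not only on neighbouring ones:
  a partial map on a finite set with gaps then still has its values in a bounded region.\<close>

definition open_Lip_inj_on ::
    "nat \<Rightarrow> (int ^ 'D::finite \<Rightarrow> bool) \<Rightarrow> (int ^ 'd::finite) set \<Rightarrow> (int ^ 'd \<Rightarrow> int ^ 'D) \<Rightarrow> bool" where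
  "open_Lip_inj_on M \<omega> S f \<longleftrightarrow> (\<forall>x\<in>S. \<omega> (f x)) \<and> inj_on f S \<and>
     (\<forall>x\<in>S. \<forall>y\<in>S. l1_norm (f x - f y) \<le> int M * l1_norm (x - y))"

lemma open_Lip_inj_on_UNIV:
  "open_Lip_inj_on M \<omega> UNIV f \<longleftrightarrow> M_Lip M f \<and> inj f \<and> range f \<subseteq> open_sites \<omega>"
  unfolding open_Lip_inj_on_def M_Lip_iff_dist open_sites_def image_subset_iff by auto

lemma open_Lip_inj_on_cong:
  assumes "\<And>x. x \<in> S \<Longrightarrow> f x = g x"
  shows "open_Lip_inj_on M \<omega> S f \<longleftrightarrow> open_Lip_inj_on M \<omega> S g"
  using assms inj_on_cong[of S f g] unfolding open_Lip_inj_on_def by simp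

lemma open_Lip_inj_on_subset:
  "S \<subseteq> T \<Longrightarrow> open_Lip_inj_on M \<omega> T f \<Longrightarrow> open_Lip_inj_on M \<omega> S f"
  unfolding open_Lip_inj_on_def using inj_on_subset by blast

text \<open>Once the value at the origin is fixed, a Lipschitz map has only finitely many possible values
  at each site, so compactness applies. Finite sets of sites are presented as lists because these
  form a countable type.\<close>

lemma ex_open_Lip_inj_iff_finite:
  fixes \<omega> :: "int ^ 'D::finite \<Rightarrow> bool"
  shows "(\<exists>f :: int ^ 'd::finite \<Rightarrow> int ^ 'D. open_Lip_inj_on M \<omega> UNIV f) \<longleftrightarrow>
    (\<exists>v. \<forall>xs :: (int ^ 'd) list. \<exists>f \<in> (\<Pi>\<^sub>E x\<in>set xs. {z. l1_norm (z - v) \<le> int M * l1_norm x}).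
       open_Lip_inj_on M \<omega> (set xs) f)"
  (is "?glob \<longleftrightarrow> (\<exists>v. \<forall>xs. \<exists>f \<in> PiE _ (?B v). _)")
proof
  assume ?glob
  then obtain f :: "int ^ 'd \<Rightarrow> int ^ 'D" where f: "open_Lip_inj_on M \<omega> UNIV f" by blast
  have "\<exists>h \<in> PiE (set xs) (?B (f 0)). open_Lip_inj_on M \<omega> (set xs) h" for xs :: "(int ^ 'd) list"
  proof (rule bexI[of _ "restrict f (set xs)"])
    show "open_Lip_inj_on M \<omega> (set xs) (restrict f (set xs))"
      using f open_Lip_inj_on_subset[of "set xs" UNIV]
      by (subst open_Lip_inj_on_cong[where g = f]) auto
    have "l1_norm (f x - f 0) \<le> int M * l1_norm (x - 0)" for x
      using f unfolding open_Lip_inj_on_def by blast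
    then show "restrict f (set xs) \<in> PiE (set xs) (?B (f 0))" by simp
  qed
  then show "\<exists>v. \<forall>xs. \<exists>f \<in> PiE (set xs) (?B v). open_Lip_inj_on M \<omega> (set xs) f" by blast
next
  assume "\<exists>v. \<forall>xs. \<exists>f \<in> PiE (set xs) (?B v). open_Lip_inj_on M \<omega> (set xs) f"
  then obtain v where v: "\<And>xs. \<exists>f \<in> PiE (set xs) (?B v). open_Lip_inj_on M \<omega> (set xs) f" by blast
  have "\<exists>g :: int ^ 'd \<Rightarrow> int ^ 'D. \<forall>S. finite S \<longrightarrow> open_Lip_inj_on M \<omega> S g"
  proof (rule finite_choices_compactness[where B = "?B v"])
    fix S :: "(int ^ 'd) set" assume "finite S"
    then obtain xs where "set xs = S" using finite_list by blast
    then show "\<exists>f \<in> PiE S (?B v). open_Lip_inj_on M \<omega> S f" using v[of xs] by simp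
  qed (use finite_l1_ball open_Lip_inj_on_cong open_Lip_inj_on_subset in blast)+
  then obtain g :: "int ^ 'd \<Rightarrow> int ^ 'D" where g: "\<And>S. finite S \<Longrightarrow> open_Lip_inj_on M \<omega> S g" by blast
  have "\<omega> (g x) \<and> (g x = g y \<longrightarrow> x = y) \<and> l1_norm (g x - g y) \<le> int M * l1_norm (x - y)" for x y
    using g[of "{x, y}"] by (auto simp: open_Lip_inj_on_def)
  then have "open_Lip_inj_on M \<omega> UNIV g"
    by (auto simp: open_Lip_inj_on_def intro: injI)
  then show ?glob by blast
qed

lemma space_site_percolation: "space (site_percolation p) = UNIV"
  unfolding site_percolation_def by (simp add: space_PiM)

lemma prob_space_site_percolation: "prob_space (site_percolation p)"
  unfolding site_percolation_def
  by (intro prob_space_PiM measure_pmf.prob_space_axioms)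

lemma measurable_site [measurable]: "Measurable.pred (site_percolation p) (\<lambda>\<omega>. \<omega> z)"
proof -
  have "(\<lambda>\<omega>. \<omega> z) \<in> measurable (site_percolation p) (measure_pmf (bernoulli_pmf p))"
    unfolding site_percolation_def by (rule measurable_component_singleton) simp
  then show ?thesis by simp
qed

definition embedding_event ::
    "'d::finite itself \<Rightarrow> nat \<Rightarrow> (int ^ 'D::finite \<Rightarrow> bool) set" where
  "embedding_event _ M = {\<omega>. \<exists>f :: int ^ 'd \<Rightarrow> int ^ 'D. open_Lip_inj_on M \<omega> UNIV f}"

lemma Lip_prob_eq:
  "Lip_prob TYPE('d::finite) TYPE('D::finite) M p =
     measure (site_percolation p :: (int ^ 'D \<Rightarrow> bool) measure) (embedding_event TYPE('d) M)"
  by (simp add: Lip_prob_def embedding_event_def space_site_percolation open_Lip_inj_on_UNIV)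

lemma embedding_event_measurable:
  "(embedding_event TYPE('d::finite) M :: (int ^ 'D::finite \<Rightarrow> bool) set) \<in> sets (site_percolation p)"
proof -
  have "Measurable.pred (site_percolation p) (\<lambda>\<omega> :: int ^ 'D \<Rightarrow> bool.
      \<exists>v. \<forall>xs :: (int ^ 'd) list.
        \<exists>f \<in> (\<Pi>\<^sub>E x\<in>set xs. {z. l1_norm (z - v) \<le> int M * l1_norm x}).
          open_Lip_inj_on M \<omega> (set xs) f)"
    unfolding open_Lip_inj_on_def
    by (intro pred_intros_countable pred_intros_finite finite_PiE finite_l1_ball finite_set
        pred_intros_logic measurable_site measurable_const) simp_all
  then show ?thesis
    unfolding embedding_event_def ex_open_Lip_inj_iff_finite
    by (simp add: pred_def space_site_percolation)
qed

section \<open>Coarse graining\<close>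

definition block :: "nat \<Rightarrow> int ^ 'D::finite \<Rightarrow> (int ^ 'D) set" where
  "block n x = {z. \<forall>i. z $ i \<in> {int n * x $ i ..< int n * x $ i + int n}}"

definition coarse :: "nat \<Rightarrow> (int ^ 'D::finite \<Rightarrow> bool) \<Rightarrow> int ^ 'D \<Rightarrow> bool" where
  "coarse n \<omega> x \<longleftrightarrow> (\<exists>z\<in>block n x. \<omega> z)"

lemma finite_block: "finite (block n x)"
  unfolding block_def by (rule finite_box) simp

lemma card_block: "card (block n x) = n ^ CARD('D)" for x :: "int ^ 'D::finite"
  unfolding block_def by (subst card_box) simp_all

lemma block_unique:
  assumes "z \<in> block n x" "z \<in> block n y"
  shows "x = y"
proof -
  have "w $ i = z $ i div int n" if "z \<in> block n w" for w i
  proof -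
    have "int n * w $ i \<le> z $ i" "z $ i < int n * w $ i + int n"
      using that by (auto simp: block_def)
    then show ?thesis
      by (intro int_div_pos_eq[symmetric, where r = "z $ i - int n * w $ i"]) auto
  qed
  then show ?thesis using assms by (simp add: vec_eq_iff)
qed

lemma l1_dist_blocks:
  fixes x y :: "int ^ 'D::finite"
  assumes "z \<in> block n x" "w \<in> block n y"
  shows "l1_norm (z - w) \<le> int n * (l1_norm (x - y) + int CARD('D))"
proof -
  have "\<bar>z $ i - w $ i\<bar> \<le> int n * \<bar>x $ i - y $ i\<bar> + int n" for i
  proof -
    have "int n * x $ i \<le> z $ i" "z $ i < int n * x $ i + int n"
      "int n * y $ i \<le> w $ i" "w $ i < int n * y $ i + int n"
      using assms by (auto simp: block_def)
    moreover have "int n * \<bar>x $ i - y $ i\<bar> = \<bar>int n * x $ i - int n * y $ i\<bar>"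
      by (simp add: abs_mult flip: right_diff_distrib)
    ultimately show ?thesis by linarith
  qed
  then have "l1_norm (z - w) \<le> (\<Sum>i\<in>UNIV. int n * \<bar>x $ i - y $ i\<bar> + int n)"
    unfolding l1_norm_def by (intro sum_mono) simp
  also have "\<dots> = int n * (l1_norm (x - y) + int CARD('D))"
    by (simp add: l1_norm_def sum.distrib sum_distrib_left algebra_simps)
  finally show ?thesis .
qed

text \<open>An embedding into the good blocks is refined by choosing an open site in each of them. Distinct
  blocks are disjoint, which keeps the map injective, and replacing blocks by sites stretches
  distances by at most the factor \<open>n\<close>, up to the diameter of a block.\<close>

lemma embedding_event_refine:
  fixes \<omega> :: "int ^ 'D::finite \<Rightarrow> bool"
  assumes "coarse n \<omega> \<in> embedding_event TYPE('d::finite) M0"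
    and M: "n * (M0 + CARD('D)) \<le> M"
  shows "\<omega> \<in> embedding_event TYPE('d) M"
proof -
  obtain f :: "int ^ 'd \<Rightarrow> int ^ 'D" where
    f: "M_Lip M0 f" "inj f" "\<And>x. coarse n \<omega> (f x)"
    using assms(1) unfolding embedding_event_def mem_Collect_eq open_Lip_inj_on_UNIV open_sites_def
    by blast
  then obtain g where g: "\<And>x. g x \<in> block n (f x)" "\<And>x. \<omega> (g x)"
    unfolding coarse_def by metis
  have "inj g"
  proof (rule injI)
    fix x y assume "g x = g y"
    then have "f x = f y" using g(1)[of x] g(1)[of y] block_unique by metis
    then show "x = y" using f(2) by (simp add: inj_eq)
  qed
  moreover have "M_Lip M g"
    unfolding M_Lip_def
  proof (intro allI impI)
    fix x y :: "int ^ 'd" assume "l1_norm (x - y) = 1"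
    then have "l1_norm (f x - f y) \<le> int M0" using f(1) by (simp add: M_Lip_def)
    then have "int n * (l1_norm (f x - f y) + int CARD('D)) \<le> int n * (int M0 + int CARD('D))"
      by (intro mult_left_mono) auto
    also have "\<dots> = int (n * (M0 + CARD('D)))" by simp
    also have "\<dots> \<le> int M" using M by (simp only: of_nat_le_iff)
    finally show "l1_norm (g x - g y) \<le> int M"
      using l1_dist_blocks[OF g(1) g(1), of x y] by linarith
  qed
  ultimately have "open_Lip_inj_on M \<omega> UNIV g"
    using g(2) by (auto simp: open_Lip_inj_on_UNIV open_sites_def)
  then show ?thesis unfolding embedding_event_def by blast
qed

lemma indep_vars_sites:
  "prob_space.indep_vars (site_percolation p) (\<lambda>_. measure_pmf (bernoulli_pmf p))
     (\<lambda>z \<omega>. \<omega> z) (UNIV :: (int ^ 'D::finite) set)"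
proof -
  interpret P: product_prob_space "\<lambda>_. measure_pmf (bernoulli_pmf p)" "UNIV :: (int ^ 'D) set"
    by unfold_locales
  interpret prob_space "site_percolation p :: (int ^ 'D \<Rightarrow> bool) measure"
    by (rule prob_space_site_percolation)
  show ?thesis
  proof (subst indep_vars_iff_distr_eq_PiM)
    show "distr (site_percolation p) (\<Pi>\<^sub>M i\<in>UNIV. measure_pmf (bernoulli_pmf p)) (\<lambda>x. \<lambda>i\<in>UNIV. x i)
      = (\<Pi>\<^sub>M i\<in>(UNIV :: (int ^ 'D) set). distr (site_percolation p) (measure_pmf (bernoulli_pmf p)) (\<lambda>\<omega>. \<omega> i))"
      unfolding site_percolation_def using P.PiM_component by (simp add: restrict_UNIV distr_id)
  qed (use measurable_site in auto)
qed

lemma prob_block_closed: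
  fixes x :: "int ^ 'D::finite"
  assumes "p \<in> {0..1}"
  shows "measure (site_percolation p) {\<omega>. \<not> coarse n \<omega> x} = (1 - p) ^ (n ^ CARD('D))"
proof -
  interpret P: product_prob_space "\<lambda>_. measure_pmf (bernoulli_pmf p)" "UNIV :: (int ^ 'D) set"
    by unfold_locales
  have "{\<omega>. \<not> coarse n \<omega> x} =
      prod_emb UNIV (\<lambda>_. measure_pmf (bernoulli_pmf p)) (block n x) (PiE (block n x) (\<lambda>_. {False}))"
    by (auto simp: prod_emb_def space_PiM coarse_def restrict_def fun_eq_iff split: if_splits)
  then have "measure (site_percolation p) {\<omega>. \<not> coarse n \<omega> x} =
      (\<Prod>z\<in>block n x. measure (measure_pmf (bernoulli_pmf p)) {False})"
    unfolding site_percolation_def using P.measure_PiM_emb[of "block n x" "\<lambda>_. {False}"]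
    by (simp add: finite_block)
  also have "\<dots> = (1 - p) ^ (n ^ CARD('D))"
    using assms by (simp add: measure_pmf_single card_block)
  finally show ?thesis .
qed

text \<open>Different blocks are disjoint, so the states of the blocks are functions of disjoint families
  of independent variables, hence independent; each is open with the probability that not all its
  \<open>n ^ D\<close> sites are closed.\<close>

lemma distr_coarse:
  assumes p: "p \<in> {0..1}"
    and q: "q = 1 - (1 - p) ^ (n ^ CARD('D))"
  shows "coarse n \<in> measurable (site_percolation p)
      (site_percolation q :: (int ^ 'D::finite \<Rightarrow> bool) measure)"
    and "distr (site_percolation p) (site_percolation q) (coarse n) =
      (site_percolation q :: (int ^ 'D \<Rightarrow> bool) measure)"
proof -
  let ?P = "site_percolation p :: (int ^ 'D \<Rightarrow> bool) measure"
  interpret prob_space ?P by (rule prob_space_site_percolation)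
  have q01: "q \<in> {0..1}" using p by (auto simp: q power_le_one)
  have meas: "Measurable.pred ?P (\<lambda>\<omega>. coarse n \<omega> x)" for x
    unfolding coarse_def by (intro pred_intros_finite finite_block measurable_site)
  have sets_q: "sets (site_percolation q) = sets (\<Pi>\<^sub>M x\<in>(UNIV :: (int ^ 'D) set). count_space (UNIV :: bool set))"
    unfolding site_percolation_def by (intro sets_PiM_cong) auto
  have "coarse n \<in> measurable ?P (\<Pi>\<^sub>M x\<in>UNIV. count_space UNIV)"
    by (rule measurable_PiM_single') (use meas in \<open>auto simp: space_PiM\<close>)
  then show "coarse n \<in> measurable ?P (site_percolation q :: (int ^ 'D \<Rightarrow> bool) measure)"
    by (simp add: measurable_cong_sets[OF refl sets_q])
  have "indep_vars (\<lambda>x. \<Pi>\<^sub>M z\<in>block n x. measure_pmf (bernoulli_pmf p))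
      (\<lambda>x \<omega>. restrict \<omega> (block n x)) UNIV"
    using indep_vars_restrict[OF indep_vars_sites, of UNIV "block n"] block_unique
    by (auto simp: disjoint_family_on_def)
  then have "indep_vars (\<lambda>_. count_space UNIV)
      (\<lambda>x \<omega>. \<exists>z\<in>block n x. restrict \<omega> (block n x) z) UNIV"
  proof (rule indep_vars_compose2)
    fix x :: "int ^ 'D"
    have "Measurable.pred (\<Pi>\<^sub>M z\<in>block n x. measure_pmf (bernoulli_pmf p)) (\<lambda>\<omega>. \<omega> z)"
      if "z \<in> block n x" for z
      using measurable_component_singleton[OF that, of "\<lambda>_. measure_pmf (bernoulli_pmf p)"] by simp
    then show "(\<lambda>\<omega>. \<exists>z\<in>block n x. \<omega> z) \<in>
        measurable (\<Pi>\<^sub>M z\<in>block n x. measure_pmf (bernoulli_pmf p)) (count_space UNIV)"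
      by (intro pred_intros_finite finite_block)
  qed
  then have "indep_vars (\<lambda>_. count_space UNIV) (\<lambda>x \<omega>. coarse n \<omega> x) UNIV"
    by (simp add: coarse_def)
  then have joint: "distr ?P (\<Pi>\<^sub>M x\<in>UNIV. count_space UNIV) (coarse n) =
      (\<Pi>\<^sub>M x\<in>UNIV. distr ?P (count_space UNIV) (\<lambda>\<omega>. coarse n \<omega> x))"
    by (subst (asm) indep_vars_iff_distr_eq_PiM) (use meas in \<open>auto simp: restrict_UNIV\<close>)
  have marginal: "distr ?P (count_space UNIV) (\<lambda>\<omega>. coarse n \<omega> x) = measure_pmf (bernoulli_pmf q)" for x
  proof (rule measure_eqI_countable[where A = UNIV])
    fix b :: bool
    have closed: "prob {\<omega>. \<not> coarse n \<omega> x} = 1 - q"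
      using prob_block_closed[OF p] q by simp
    have "prob {\<omega>. coarse n \<omega> x} = q"
      using prob_neg[of "\<lambda>\<omega>. coarse n \<omega> x"] meas[of x] closed
      by (simp add: space_site_percolation pred_def)
    then have "prob {\<omega>. coarse n \<omega> x = b} = pmf (bernoulli_pmf q) b"
      using closed q01 by (cases b) simp_all
    moreover have "(\<lambda>\<omega>. coarse n \<omega> x) -` {b} = {\<omega>. coarse n \<omega> x = b}" by auto
    ultimately show "emeasure (distr ?P (count_space UNIV) (\<lambda>\<omega>. coarse n \<omega> x)) {b} =
        emeasure (measure_pmf (bernoulli_pmf q)) {b}"
      using meas[of x]
      by (simp add: emeasure_distr space_site_percolation emeasure_eq_measure emeasure_pmf_single)
  qed (auto)
  show "distr ?P (site_percolation q) (coarse n) = site_percolation q"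
    using distr_cong[OF refl sets_q, of ?P "coarse n" "coarse n"] joint
    by (simp add: marginal site_percolation_def[of q])
qed

lemma Lip_prob_refine:
  assumes p: "p \<in> {0..1}"
    and one: "Lip_prob TYPE('d::finite) TYPE('D::finite) M0 (1 - (1 - p) ^ (n ^ CARD('D))) = 1"
    and M: "n * (M0 + CARD('D)) \<le> M"
  shows "Lip_prob TYPE('d) TYPE('D) M p = 1"
proof -
  define q where "q = 1 - (1 - p) ^ (n ^ CARD('D))"
  let ?P = "site_percolation p :: (int ^ 'D \<Rightarrow> bool) measure"
  let ?E = "embedding_event TYPE('d) :: nat \<Rightarrow> (int ^ 'D \<Rightarrow> bool) set"
  interpret prob_space ?P by (rule prob_space_site_percolation)
  note coarse = distr_coarse[OF p q_def]
  have "1 = measure (distr ?P (site_percolation q) (coarse n)) (?E M0)"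
    using one by (simp add: Lip_prob_eq coarse(2) q_def[symmetric])
  also have "\<dots> = prob (coarse n -` ?E M0)"
    using measure_distr[OF coarse(1) embedding_event_measurable]
    by (simp add: space_site_percolation)
  also have "\<dots> \<le> prob (?E M)"
    by (rule finite_measure_mono[OF _ embedding_event_measurable])
      (use embedding_event_refine[OF _ M] in auto)
  finally show ?thesis using prob_le_1[of "?E M"] by (simp add: Lip_prob_eq)
qed

section \<open>Vanishing of the critical probability\<close>

theorem proposition3:
  assumes "M_crit TYPE('d::finite) TYPE('D::finite) < \<infinity>"
  shows "(\<lambda>M. p_crit TYPE('d) TYPE('D) M) \<longlonglongrightarrow> 0"
proof -
  have "\<exists>M0. p_crit TYPE('d) TYPE('D) M0 < 1"
    using assms unfolding M_crit_def Inf_less_iff by auto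
  then obtain M0 p0 where p0: "p0 \<in> {0..1}" "p0 < 1" "Lip_prob TYPE('d) TYPE('D) M0 p0 = 1"
    unfolding p_crit_def Inf_less_iff by auto
  \<comment> \<open>The parameter at which blocks of side \<open>n\<close> are good with probability exactly \<open>p0\<close>.\<close>
  define p where "p n = 1 - (1 - p0) powr (1 / real (n ^ CARD('D)))" for n :: nat
  have p01: "p n \<in> {0..1}" for n
    using p0 by (auto simp: p_def intro: powr_le1)
  have bound: "p_crit TYPE('d) TYPE('D) M \<le> ereal (p n)"
    if "n \<ge> 1" "n * (M0 + CARD('D)) \<le> M" for n M
  proof -
    have "(1 - p n) ^ (n ^ CARD('D)) = 1 - p0"
      using p0 that(1) by (simp add: p_def powr_powr flip: powr_realpow)
    then have "Lip_prob TYPE('d) TYPE('D) M (p n) = 1"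
      using p0(3) by (intro Lip_prob_refine[OF p01 _ that(2)]) simp
    then show ?thesis
      unfolding p_crit_def using p01 by (intro Inf_lower) auto
  qed
  have "(\<lambda>n. 1 / real (n ^ CARD('D))) \<longlonglongrightarrow> 0"
    by (rule tendsto_divide_0[OF tendsto_const])
      (simp add: filterlim_at_infinity_conv_norm_at_top filterlim_pow_at_top filterlim_real_sequentially)
  then have "p \<longlonglongrightarrow> 1 - (1 - p0) powr 0"
    unfolding p_def using p0(2) by (intro tendsto_intros) auto
  then have p_lim: "p \<longlonglongrightarrow> 0" using p0(2) by simp
  show ?thesis
  proof (rule order_tendstoI)
    fix a :: ereal assume "a < 0"
    have "0 \<le> p_crit TYPE('d) TYPE('D) M" for M
      unfolding p_crit_def by (intro Inf_greatest) auto
    then show "\<forall>\<^sub>F M in sequentially. a < p_crit TYPE('d) TYPE('D) M"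
      using \<open>a < 0\<close> by (intro always_eventually allI) (rule less_le_trans)
  next
    fix a :: ereal assume "0 < a"
    have "(\<lambda>n. ereal (p n)) \<longlonglongrightarrow> 0"
      using p_lim by (simp add: zero_ereal_def)
    then have "\<forall>\<^sub>F n in sequentially. ereal (p n) < a \<and> n \<ge> 1"
      using \<open>0 < a\<close> by (intro eventually_conj order_tendstoD eventually_ge_at_top)
    then obtain n where n: "ereal (p n) < a" "n \<ge> 1"
      by (auto simp: eventually_sequentially)
    show "\<forall>\<^sub>F M in sequentially. p_crit TYPE('d) TYPE('D) M < a"
      using eventually_ge_at_top[of "n * (M0 + CARD('D))"]
      by eventually_elim (rule le_less_trans[OF bound[OF n(2)] n(1)])
  qed
qed

end
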